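(* Let $B$ be a left semi-brace such that $(G,+)$ is a nilpotent group. Then $B$ is right nilpotent if and only if $B$ admits a $z$-series.
   Context: A left semi-brace is a set $B$ with two operations $+$ and $\circ$ such that $(B,+)$ is a left cancellative semigroup (not necessarily commutative), $(B,\circ)$ is a group, and $a\circ(b+c)=a\circ b+a\circ(a^-+c)$ for all $a,b,c\in B$, where $a^-$ is the inverse of $a$ in $(B,\circ)$ and $\circ$ has higher precedence than $+$. The identity of $(B,\circ)$ is denoted $0$; it is an idempotent and a left identity of $(B,+)$. Let $E$ be the set of idempotents of $(B,+)$ and $G=B+0=\{b+0: b\in B\}$, which is a subgroup of $(B,+)$ (with identity $0$). For $a,b\in B$ put $\lambda_a(b)=a\circ(a^-+b)$, $\rho_b(a)=(a^-+b)^-\circ b$, and define the operation $a\cdot b=\lambda_a(a^-)+a\circ b+\lambda_b(b^-)$; one has $a\cdot b\in G$. For subsets $X,Y\subseteq B$, $X\cdot Y$ denotes the subgroup of $(G,+)$ generated by all $x\cdot y$ with $x\in X$, $y\in Y$, and $X+Y=\{x+y:x\in X,y\in Y\}$. A subsemigroup $I$ of $(B,+)$ is an ideal of $B$ if: (i) $I$ is a normal subgroup of $(B,\circ)$; (ii) $I\cap G$ is a normal subgroup of $(G,+)$; (iii) $\rho_b(n)\in I$ for all $b\in B$, $n\in I\cap G$; (iv) $\lambda_g(e)\in I$ for all $g\in G$, $e\in I\cap E$. For an ideal $I$, $B/I$ is the quotient group $(B,\circ)/I$ with the induced addition (which is well defined); it is a left semi-brace. The socle of a left semi-brace $B$ is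 $\operatorname{Soc}(B)=\{a\in B:\rho_a=\rho_0,\ \lambda_a=\lambda_0\}$. The right series of $B$ is $B^{(1)}=B$, $B^{(n+1)}=B^{(n)}\cdot B+E$ for $n\ge 1$; $B$ is right nilpotent if $B^{(n)}=E$ for some positive integer $n$. A $z$-series of $B$ is a finite sequence $B=I_0\supseteq I_1\supseteq\cdots\supseteq I_n=E$ of ideals of $B$ such that $I_{j-1}/I_j\subseteq\operatorname{Soc}(B/I_j)$ for every $j\in\{1,\dots,n\}$. *)

theory Defs
  imports "HOL-Algebra.Generated_Groups"
begin

text \<open>
  The multiplicative structure \<open>(B, \<circ>)\<close> is the underlying \<open>monoid\<close> record, so \<open>\<otimes>\<close> stands for
  \<open>\<circ>\<close>, \<open>inv a\<close> for the inverse with respect to \<open>\<circ>\<close>, and \<open>\<one>\<close> for the element that is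
  denoted \<open>0\<close> in the literature on semi-braces. The addition is \<open>\<boxplus>\<close>.
\<close>

record 'a semibrace = "'a monoid" +
  sadd :: "'a \<Rightarrow> 'a \<Rightarrow> 'a" (infixl \<open>\<boxplus>\<index>\<close> 65)

locale left_semibrace = group B for B (structure) +
  assumes sadd_closed: "\<lbrakk>a \<in> carrier B; b \<in> carrier B\<rbrakk> \<Longrightarrow> a \<boxplus> b \<in> carrier B"
    and sadd_assoc: "\<lbrakk>a \<in> carrier B; b \<in> carrier B; c \<in> carrier B\<rbrakk>
          \<Longrightarrow> (a \<boxplus> b) \<boxplus> c = a \<boxplus> (b \<boxplus> c)"
    and sadd_left_cancel: "\<lbrakk>a \<in> carrier B; b \<in> carrier B; c \<in> carrier B; a \<boxplus> b = a \<boxplus> c\<rbrakk>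
          \<Longrightarrow> b = c"
    and semi_distrib: "\<lbrakk>a \<in> carrier B; b \<in> carrier B; c \<in> carrier B\<rbrakk>
          \<Longrightarrow> a \<otimes> (b \<boxplus> c) = a \<otimes> b \<boxplus> a \<otimes> (inv a \<boxplus> c)"

definition sb_idempotents :: "('a, 'm) semibrace_scheme \<Rightarrow> 'a set" where
  "sb_idempotents B = {e \<in> carrier B. e \<boxplus>\<^bsub>B\<^esub> e = e}"

text \<open>The additive group \<open>(G, +)\<close> with \<open>G = B + 0\<close>.\<close>

definition sb_group :: "('a, 'm) semibrace_scheme \<Rightarrow> 'a monoid" where
  "sb_group B = \<lparr>carrier = (\<lambda>b. b \<boxplus>\<^bsub>B\<^esub> \<one>\<^bsub>B\<^esub>) ` carrier B, mult = sadd B, one = \<one>\<^bsub>B\<^esub>\<rparr>"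

definition sb_lambda :: "('a, 'm) semibrace_scheme \<Rightarrow> 'a \<Rightarrow> 'a \<Rightarrow> 'a" where
  "sb_lambda B a b = a \<otimes>\<^bsub>B\<^esub> (inv\<^bsub>B\<^esub> a \<boxplus>\<^bsub>B\<^esub> b)"

text \<open>The subscript is the first argument: \<open>sb_rho B b a\<close> is \<open>\<rho>\<^sub>b(a)\<close>.\<close>

definition sb_rho :: "('a, 'm) semibrace_scheme \<Rightarrow> 'a \<Rightarrow> 'a \<Rightarrow> 'a" where
  "sb_rho B b a = inv\<^bsub>B\<^esub> (inv\<^bsub>B\<^esub> a \<boxplus>\<^bsub>B\<^esub> b) \<otimes>\<^bsub>B\<^esub> b"

definition sb_dot :: "('a, 'm) semibrace_scheme \<Rightarrow> 'a \<Rightarrow> 'a \<Rightarrow> 'a" where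
  "sb_dot B a b =
     sb_lambda B a (inv\<^bsub>B\<^esub> a) \<boxplus>\<^bsub>B\<^esub> a \<otimes>\<^bsub>B\<^esub> b \<boxplus>\<^bsub>B\<^esub> sb_lambda B b (inv\<^bsub>B\<^esub> b)"

definition sb_dot_set :: "('a, 'm) semibrace_scheme \<Rightarrow> 'a set \<Rightarrow> 'a set \<Rightarrow> 'a set" where
  "sb_dot_set B X Y = generate (sb_group B) {sb_dot B x y | x y. x \<in> X \<and> y \<in> Y}"

definition sb_add_set :: "('a, 'm) semibrace_scheme \<Rightarrow> 'a set \<Rightarrow> 'a set \<Rightarrow> 'a set" where
  "sb_add_set B X Y = {x \<boxplus>\<^bsub>B\<^esub> y | x y. x \<in> X \<and> y \<in> Y}"

definition sb_ideal :: "'a set \<Rightarrow> ('a, 'm) semibrace_scheme \<Rightarrow> bool" where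
  "sb_ideal I B \<longleftrightarrow>
     I \<subseteq> carrier B \<and> (\<forall>x\<in>I. \<forall>y\<in>I. x \<boxplus>\<^bsub>B\<^esub> y \<in> I) \<and>
     I \<lhd> B \<and>
     (I \<inter> carrier (sb_group B)) \<lhd> sb_group B \<and>
     (\<forall>b\<in>carrier B. \<forall>n\<in>I \<inter> carrier (sb_group B). sb_rho B b n \<in> I) \<and>
     (\<forall>g\<in>carrier (sb_group B). \<forall>e\<in>I \<inter> sb_idempotents B. sb_lambda B g e \<in> I)"

text \<open>
  The sum of two cosets is the union of the cosets of all sums of representatives; for an ideal
  these cosets coincide, as for \<open>rcoset_mult\<close> in the case of rings.
\<close>

definition sb_quotient :: "('a, 'm) semibrace_scheme \<Rightarrow> 'a set \<Rightarrow> 'a set semibrace" where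
  "sb_quotient B I =
     \<lparr>carrier = carrier (B Mod I), mult = mult (B Mod I), one = one (B Mod I),
      sadd = (\<lambda>X Y. \<Union>x\<in>X. \<Union>y\<in>Y. I #>\<^bsub>B\<^esub> (x \<boxplus>\<^bsub>B\<^esub> y))\<rparr>"

definition sb_socle :: "('a, 'm) semibrace_scheme \<Rightarrow> 'a set" where
  "sb_socle B = {a \<in> carrier B.
     (\<forall>b\<in>carrier B. sb_rho B a b = sb_rho B \<one>\<^bsub>B\<^esub> b) \<and>
     (\<forall>b\<in>carrier B. sb_lambda B a b = sb_lambda B \<one>\<^bsub>B\<^esub> b)}"

text \<open>The right series starts at index 1; the value at 0 is a dummy.\<close>

fun sb_right_series :: "('a, 'm) semibrace_scheme \<Rightarrow> nat \<Rightarrow> 'a set" where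
  "sb_right_series B 0 = carrier B"
| "sb_right_series B (Suc 0) = carrier B"
| "sb_right_series B (Suc (Suc n)) =
     sb_add_set B (sb_dot_set B (sb_right_series B (Suc n)) (carrier B)) (sb_idempotents B)"

definition sb_right_nilpotent :: "('a, 'm) semibrace_scheme \<Rightarrow> bool" where
  "sb_right_nilpotent B \<longleftrightarrow> (\<exists>n\<ge>1. sb_right_series B n = sb_idempotents B)"

text \<open>
  \<open>sb_z_series B I n\<close>: the finite sequence \<open>I 0, \<dots>, I n\<close> is a \<open>z\<close>-series of \<open>B\<close>.
\<close>

definition sb_z_series :: "('a, 'm) semibrace_scheme \<Rightarrow> (nat \<Rightarrow> 'a set) \<Rightarrow> nat \<Rightarrow> bool" where
  "sb_z_series B I n \<longleftrightarrow>
     I 0 = carrier B \<and> I n = sb_idempotents B \<and>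
     (\<forall>j\<le>n. sb_ideal (I j) B) \<and>
     (\<forall>j\<in>{1..n}. I j \<subseteq> I (j - 1)) \<and>
     (\<forall>j\<in>{1..n}. carrier (B\<lparr>carrier := I (j - 1)\<rparr> Mod I j) \<subseteq> sb_socle (sb_quotient B (I j)))"

primrec lower_central :: "('a, 'm) monoid_scheme \<Rightarrow> nat \<Rightarrow> 'a set" where
  "lower_central G 0 = carrier G"
| "lower_central G (Suc n) =
     generate G {x \<otimes>\<^bsub>G\<^esub> y \<otimes>\<^bsub>G\<^esub> inv\<^bsub>G\<^esub> x \<otimes>\<^bsub>G\<^esub> inv\<^bsub>G\<^esub> y | x y. x \<in> lower_central G n \<and> y \<in> carrier G}"

definition nilpotent_group :: "('a, 'm) monoid_scheme \<Rightarrow> bool" where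
  "nilpotent_group G \<longleftrightarrow> group G \<and> (\<exists>n. lower_central G n = {\<one>\<^bsub>G\<^esub>})"

end

theory Submission
  imports Defs "HOL-Algebra.SndIsomorphismGrp"
begin

text \<open>
  Write \<open>0\<close> for the identity of \<open>(B, \<circ>)\<close>. The map \<open>\<pi>(b) = b + 0\<close> is a homomorphism from \<open>(B, +)\<close>
  onto the group \<open>(G, +)\<close> whose fibre over \<open>0\<close> is \<open>E\<close>. The maps \<open>\<lambda>\<^sub>a\<close> induce, via \<open>\<pi>\<close>, an action of
  \<open>(B, \<circ>)\<close> on \<open>(G, +)\<close> by automorphisms, written \<open>act a\<close>; with respect to it \<open>\<pi>\<close> is a
  1-cocycle, \<open>\<pi>(a \<circ> b) = \<pi>(a) + act a (\<pi>(b))\<close>, and \<open>a \<cdot> b = act a (\<pi>(b)) - \<pi>(b)\<close>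
  (\<open>proj_mult\<close>, \<open>sb_dot_eq\<close>). So everything can be computed in \<open>G\<close>.

  The ideals that contain \<open>E\<close> are exactly the preimages \<open>\<pi>\<^sup>-\<^sup>1(N)\<close> of the normal subgroups \<open>N\<close> of \<open>G\<close>
  that are stable under the action and for which \<open>\<pi>\<^sup>-\<^sup>1(N)\<close> acts trivially on \<open>G/N\<close>; these \<open>N\<close> are called
  admissible (\<open>lift_ideal\<close>, \<open>ideal_admissible\<close>). Modulo such an ideal, the class of \<open>a\<close> lies in the
  socle if \<open>a\<close> acts trivially on \<open>G/N\<close> and \<open>\<pi>(a)\<close> is central in \<open>G/N\<close>; and trivial action is
  necessary for this (\<open>coset_in_socleI\<close>, \<open>coset_in_socleD\<close>).

  Let \<open>D(N)\<close> be the subgroup generated by all \<open>a \<cdot> b\<close> with \<open>\<pi>(a) \<in> N\<close>. If \<open>N\<close> is admissible then so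
  is \<open>D(N) \<subseteq> N\<close>, and the terms of the right series are the preimages of \<open>D\<^sup>n(G)\<close>; hence \<open>B\<close> is right
  nilpotent iff \<open>D\<^sup>n(G) = 0\<close> for some \<open>n\<close>. Given a \<open>z\<close>-series \<open>I\<^sub>0, \<dots>, I\<^sub>n\<close>, triviality of the action
  gives \<open>D(I\<^sub>j \<inter> G) \<subseteq> I\<^sub>j\<^sub>+\<^sub>1 \<inter> G\<close>, so \<open>D\<^sup>n(G) \<subseteq> E \<inter> G = 0\<close>.

  Conversely, the preimage of each term of the sequence \<open>D\<^sup>n(G)\<close> acts trivially on \<open>G\<close> modulo the next
  term, but the factors of the sequence need not be central.
  If \<open>N\<close> is one of its terms and \<open>M = D(N)\<close> the next one, the subgroups \<open>N \<inter> (M + \<gamma>\<^sub>k(G))\<close>, where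
  \<open>\<gamma>\<^sub>k(G)\<close> is the lower central series, interpolate between \<open>N\<close> and \<open>M\<close> in finitely many steps
  because \<open>G\<close> is nilpotent. They are admissible since \<open>\<gamma>\<^sub>k(G)\<close> is fully invariant, and consecutive
  ones have central factors (\<open>central_step_refinement\<close>). Their preimages form a \<open>z\<close>-series.
\<close>

section \<open>The lower central series\<close>

context group
begin

lemma inv_cancel:
  assumes "x \<in> carrier G" "y \<in> carrier G"
  shows "x \<otimes> (inv x \<otimes> y) = y" and "inv x \<otimes> (x \<otimes> y) = y"
  using assms by (simp_all add: m_assoc[symmetric])

lemma conj_hom: "g \<in> carrier G \<Longrightarrow> (\<lambda>x. g \<otimes> x \<otimes> inv g) \<in> hom G G"
  by (rule homI) (simp_all add: m_assoc inv_cancel)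

lemma hom_image_generate_subset:
  assumes h: "h \<in> hom G G" and S: "S \<subseteq> carrier G" and "h ` S \<subseteq> generate G S"
  shows "h ` generate G S \<subseteq> generate G S"
proof -
  interpret h: group_hom G G h by (simp add: group_hom_def group_hom_axioms_def h group_axioms)
  have "h ` generate G S = generate G (h ` S)" using h.generate_img[OF S] by simp
  also have "\<dots> \<subseteq> generate G S"
    by (rule generate_subgroup_incl[OF assms(3) generate_is_subgroup[OF S]])
  finally show ?thesis .
qed

text \<open>Modulo a normal subgroup that contains \<open>m\<close>, the commutators of \<open>m c\<close> and of \<open>c\<close> with \<open>g\<close> agree.\<close>

lemma commutator_mult_left:
  assumes "m \<in> carrier G" "c \<in> carrier G" "g \<in> carrier G"
    and d: "d = c \<otimes> g \<otimes> inv c \<otimes> inv g"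
  shows "m \<otimes> c \<otimes> g \<otimes> inv (m \<otimes> c) \<otimes> inv g = m \<otimes> (d \<otimes> (g \<otimes> inv m \<otimes> inv g) \<otimes> inv d) \<otimes> d"
  using assms by (simp add: m_assoc inv_cancel inv_mult_group)

lemma lower_central_subgroup: "subgroup (lower_central G n) G"
proof (induction n)
  case (Suc n)
  then have "lower_central G n \<subseteq> carrier G" by (rule subgroup.subset)
  then show ?case by (auto intro!: generate_is_subgroup)
qed (simp add: subgroup_self)

lemma commutator_in_lower_central:
  "\<lbrakk>x \<in> lower_central G n; y \<in> carrier G\<rbrakk> \<Longrightarrow> x \<otimes> y \<otimes> inv x \<otimes> inv y \<in> lower_central G (Suc n)"
  by (auto intro: generate.incl)

lemma lower_central_fully_invariant:
  assumes h: "h \<in> hom G G" shows "h ` lower_central G n \<subseteq> lower_central G n"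
proof (induction n)
  case 0
  then show ?case using h by (auto simp: hom_def)
next
  case (Suc n)
  interpret h: group_hom G G h by (simp add: group_hom_def group_hom_axioms_def h group_axioms)
  have sub: "lower_central G n \<subseteq> carrier G"
    using lower_central_subgroup by (rule subgroup.subset)
  show ?case
    unfolding lower_central.simps
  proof (rule hom_image_generate_subset[OF h], unfold lower_central.simps(2)[symmetric], safe)
    fix x y assume xy: "x \<in> lower_central G n" "y \<in> carrier G"
    with sub show "x \<otimes> y \<otimes> inv x \<otimes> inv y \<in> carrier G" by auto
    have "h (x \<otimes> y \<otimes> inv x \<otimes> inv y) = h x \<otimes> h y \<otimes> inv (h x) \<otimes> inv (h y)"
      using xy sub by auto
    then show "h (x \<otimes> y \<otimes> inv x \<otimes> inv y) \<in> lower_central G (Suc n)"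
      using xy Suc.IH commutator_in_lower_central[of "h x" n "h y"] by auto
  qed
qed

text \<open>Conjugations are endomorphisms, so full invariance gives normality.\<close>

lemma lower_central_normal: "lower_central G n \<lhd> G"
  using lower_central_fully_invariant[OF conj_hom] lower_central_subgroup
  by (auto simp: normal_inv_iff)

lemma lower_central_Suc_subset: "lower_central G (Suc n) \<subseteq> lower_central G n"
proof -
  interpret C: normal "lower_central G n" G by (rule lower_central_normal)
  have "x \<otimes> y \<otimes> inv x \<otimes> inv y \<in> lower_central G n"
    if "x \<in> lower_central G n" "y \<in> carrier G" for x y
    using that C.m_closed[OF that(1) C.inv_op_closed2[OF that(2) C.m_inv_closed[OF that(1)]]]
    by (simp add: m_assoc)
  then show ?thesis
    unfolding lower_central.simps by (intro generate_subgroup_incl[OF _ C.subgroup_axioms]) blast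
qed

end

section \<open>The additive structure of a left semi-brace\<close>

context left_semibrace
begin

abbreviation G where "G \<equiv> sb_group B"
abbreviation E where "E \<equiv> sb_idempotents B"
abbreviation lam where "lam \<equiv> sb_lambda B"

lemma one_sadd [simp]:
  assumes "b \<in> carrier B" shows "\<one> \<boxplus> b = b"
proof -
  have "b \<boxplus> b = b \<boxplus> (\<one> \<boxplus> b)"
    using semi_distrib[of \<one> b b] assms by (simp add: sadd_closed)
  then show ?thesis using sadd_left_cancel[of b b "\<one> \<boxplus> b"] assms by (simp add: sadd_closed)
qed

lemma lam_closed [simp]: "\<lbrakk>a \<in> carrier B; b \<in> carrier B\<rbrakk> \<Longrightarrow> lam a b \<in> carrier B"
  by (simp add: sb_lambda_def sadd_closed)

lemma lam_one [simp]: "b \<in> carrier B \<Longrightarrow> lam \<one> b = b"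
  by (simp add: sb_lambda_def)

lemma lam_sadd:
  "\<lbrakk>a \<in> carrier B; b \<in> carrier B; c \<in> carrier B\<rbrakk> \<Longrightarrow> lam a (b \<boxplus> c) = lam a b \<boxplus> lam a c"
  unfolding sb_lambda_def
  using semi_distrib[of a "inv a \<boxplus> b" c] by (simp add: sadd_closed sadd_assoc)

lemma lam_mult:
  assumes "a \<in> carrier B" "b \<in> carrier B" "c \<in> carrier B"
  shows "lam (a \<otimes> b) c = lam a (lam b c)"
proof -
  have "b \<otimes> (inv b \<otimes> inv a \<boxplus> c) = inv a \<boxplus> lam b c"
    using semi_distrib[of b "inv b \<otimes> inv a" c] assms
    by (simp add: sb_lambda_def m_assoc[symmetric])
  then show ?thesis using assms by (simp add: sb_lambda_def inv_mult_group m_assoc sadd_closed)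
qed

lemma mult_eq_sadd:
  assumes "a \<in> carrier B" "b \<in> carrier B" shows "a \<otimes> b = a \<boxplus> lam a b"
  using semi_distrib[of a \<one> b] assms by (simp add: sb_lambda_def)

text \<open>
  The element \<open>\<lambda>\<^sub>b(b\<^sup>-)\<close> is a right inverse of \<open>b\<close> with respect to \<open>+\<close>; it turns out to be the negative
  of \<open>b + 0\<close> in \<open>G\<close>.
\<close>

lemma sadd_neg: "b \<in> carrier B \<Longrightarrow> b \<boxplus> lam b (inv b) = \<one>"
  using mult_eq_sadd[of b "inv b"] by simp

text \<open>The projection \<open>\<pi>\<close> of \<open>(B, +)\<close> onto its subgroup \<open>G\<close>.\<close>

definition proj :: "'a \<Rightarrow> 'a" where
  "proj b = b \<boxplus> \<one>"

lemma carrier_G: "carrier G = {b \<in> carrier B. proj b = b}"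
  by (auto simp: sb_group_def proj_def sadd_closed sadd_assoc intro!: image_eqI)

lemma mult_G: "x \<otimes>\<^bsub>G\<^esub> y = x \<boxplus> y" and one_G: "\<one>\<^bsub>G\<^esub> = \<one>"
  by (simp_all add: sb_group_def)

lemma G_into_B: "x \<in> carrier G \<Longrightarrow> x \<in> carrier B"
  by (simp add: carrier_G)

lemma proj_closed [simp]: "b \<in> carrier B \<Longrightarrow> proj b \<in> carrier G"
  by (simp add: sb_group_def proj_def)

lemma proj_G: "x \<in> carrier G \<Longrightarrow> proj x = x"
  by (simp add: carrier_G)

lemma proj_one [simp]: "proj \<one> = \<one>"
  by (simp add: proj_def)

lemma proj_sadd:
  assumes "a \<in> carrier B" "b \<in> carrier B"
  shows "proj (a \<boxplus> b) = proj a \<otimes>\<^bsub>G\<^esub> proj b"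
  using assms by (simp add: mult_G proj_def sadd_assoc sadd_closed)

lemma neg_in_G: assumes "b \<in> carrier B" shows "lam b (inv b) \<in> carrier G"
proof -
  have "b \<boxplus> proj (lam b (inv b)) = b \<boxplus> lam b (inv b)"
    using assms sadd_neg[of b] sadd_assoc[of b "lam b (inv b)" \<one>] by (simp add: proj_def)
  then have "proj (lam b (inv b)) = lam b (inv b)"
    using assms sadd_left_cancel[of b "proj (lam b (inv b))" "lam b (inv b)"]
    by (simp add: G_into_B)
  then show ?thesis using assms by (simp add: carrier_G)
qed

lemma group_G: "group G"
proof (rule groupI)
  have inv_ex: "\<exists>y\<in>carrier G. x \<otimes>\<^bsub>G\<^esub> y = \<one>\<^bsub>G\<^esub>" if "x \<in> carrier G" for x
    using that neg_in_G[of x] sadd_neg[of x] by (auto simp: mult_G one_G G_into_B)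
  show assoc: "x \<otimes>\<^bsub>G\<^esub> y \<otimes>\<^bsub>G\<^esub> z = x \<otimes>\<^bsub>G\<^esub> (y \<otimes>\<^bsub>G\<^esub> z)"
    if "x \<in> carrier G" "y \<in> carrier G" "z \<in> carrier G" for x y z
    using that by (simp add: mult_G G_into_B sadd_assoc)
  show "\<exists>y\<in>carrier G. y \<otimes>\<^bsub>G\<^esub> x = \<one>\<^bsub>G\<^esub>" if x: "x \<in> carrier G" for x
  proof -
    obtain y where y: "y \<in> carrier G" "x \<boxplus> y = \<one>"
      using inv_ex[OF x] by (auto simp: mult_G one_G)
    obtain z where z: "z \<in> carrier G" "y \<boxplus> z = \<one>"
      using inv_ex[OF y(1)] by (auto simp: mult_G one_G)
    have "x = x \<boxplus> (y \<boxplus> z)" using x z proj_G[of x] by (simp add: proj_def)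
    also have "\<dots> = z" using x y z sadd_assoc[of x y z] by (simp add: G_into_B)
    finally have "y \<boxplus> x = \<one>" using z by simp
    then show ?thesis using y by (auto simp: mult_G one_G)
  qed
  show "x \<otimes>\<^bsub>G\<^esub> y \<in> carrier G" if "x \<in> carrier G" "y \<in> carrier G" for x y
    using that by (auto simp: carrier_G mult_G sadd_closed sadd_assoc proj_def)
  show "\<one>\<^bsub>G\<^esub> \<in> carrier G" by (simp add: carrier_G one_G)
  show "\<one>\<^bsub>G\<^esub> \<otimes>\<^bsub>G\<^esub> x = x" if "x \<in> carrier G" for x
    using that by (simp add: mult_G one_G G_into_B)
qed

sublocale G: group G by (rule group_G)

lemmas G_simps = G.m_assoc G.inv_cancel G.inv_mult_group

lemma neg_eq_inv: "b \<in> carrier B \<Longrightarrow> lam b (inv b) = inv\<^bsub>G\<^esub> (proj b)"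
  using proj_sadd[of b "lam b (inv b)"] neg_in_G[of b]
    G.inv_equality[OF G.inv_comm, of "proj b" "lam b (inv b)"]
  by (simp add: sadd_neg proj_G one_G)

lemma idempotents_eq: "E = {b \<in> carrier B. proj b = \<one>}"
proof -
  have "proj b = \<one>" if "b \<in> carrier B" "b \<boxplus> b = b" for b
    using that sadd_assoc[of b b \<one>] sadd_left_cancel[of b "b \<boxplus> \<one>" \<one>]
    by (simp add: proj_def sadd_closed)
  moreover have "b \<boxplus> b = b" if "b \<in> carrier B" "proj b = \<one>" for b
    using that sadd_assoc[of b \<one> b] by (simp add: proj_def)
  ultimately show ?thesis by (auto simp: sb_idempotents_def)
qed

section \<open>The action on the additive group and the cocycle\<close>

text \<open>The action of \<open>(B, \<circ>)\<close> on \<open>G\<close> that is induced by \<open>\<lambda>\<close>; it is meant for \<open>g \<in> G\<close>.\<close>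

definition act :: "'a \<Rightarrow> 'a \<Rightarrow> 'a" where
  "act a g = proj (lam a g)"

text \<open>
  The element \<open>\<pi>(\<lambda>\<^sub>a(b))\<close> only depends on \<open>a\<close> and \<open>\<pi>(b)\<close>: since \<open>\<lambda>\<^sub>a\<close> is additive, \<open>\<lambda>\<^sub>a(0)\<close> is an
  idempotent, which \<open>\<pi>\<close> sends to \<open>0\<close>.
\<close>

lemma proj_lam:
  assumes "a \<in> carrier B" "b \<in> carrier B" shows "proj (lam a b) = act a (proj b)"
proof -
  have "lam a \<one> \<in> E"
    using assms lam_sadd[of a \<one> \<one>] by (simp add: sb_idempotents_def)
  then have "proj (lam a \<one>) = \<one>" by (simp add: idempotents_eq)
  then show ?thesis
    using assms lam_sadd[of a b \<one>] proj_sadd[of "lam a b" "lam a \<one>"] G.r_one[of "proj (lam a b)"]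
    by (simp add: act_def one_G proj_def[of b])
qed

lemma act_closed [simp]: "\<lbrakk>a \<in> carrier B; g \<in> carrier G\<rbrakk> \<Longrightarrow> act a g \<in> carrier G"
  by (simp add: act_def G_into_B)

lemma act_hom: "a \<in> carrier B \<Longrightarrow> act a \<in> hom G G"
proof (rule homI)
  fix x y assume a: "a \<in> carrier B" and "x \<in> carrier G" "y \<in> carrier G"
  then show "act a (x \<otimes>\<^bsub>G\<^esub> y) = act a x \<otimes>\<^bsub>G\<^esub> act a y"
    by (simp add: act_def mult_G[of x] lam_sadd G_into_B proj_sadd)
qed simp

lemma act_mult:
  "\<lbrakk>a \<in> carrier B; b \<in> carrier B; g \<in> carrier G\<rbrakk> \<Longrightarrow> act (a \<otimes> b) g = act a (act b g)"
  using proj_lam[of a "lam b g"] by (simp add: act_def lam_mult G_into_B)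

lemma act_one [simp]: "g \<in> carrier G \<Longrightarrow> act \<one> g = g"
  by (simp add: act_def G_into_B proj_G)

lemma act_inv_act [simp]:
  assumes "a \<in> carrier B" "g \<in> carrier G"
  shows "act (inv a) (act a g) = g" and "act a (act (inv a) g) = g"
  using assms by (simp_all add: act_mult[symmetric])

lemma proj_mult:
  assumes "a \<in> carrier B" "b \<in> carrier B"
  shows "proj (a \<otimes> b) = proj a \<otimes>\<^bsub>G\<^esub> act a (proj b)"
  using assms by (simp add: mult_eq_sadd proj_sadd proj_lam)

lemma proj_inv: assumes "a \<in> carrier B" shows "proj (inv a) = act (inv a) (inv\<^bsub>G\<^esub> (proj a))"
proof -
  have "act (inv a) (proj (lam a (inv a))) = act (inv a) (inv\<^bsub>G\<^esub> (proj a))"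
    using assms by (simp add: neg_eq_inv proj_G)
  then show ?thesis using assms by (simp add: proj_lam)
qed

lemma proj_inv_mult:
  assumes "x \<in> carrier B" "y \<in> carrier B"
  shows "proj (inv y \<otimes> x) = act (inv y) (inv\<^bsub>G\<^esub> (proj y) \<otimes>\<^bsub>G\<^esub> proj x)"
  using assms hom_mult[OF act_hom, of "inv y" "inv\<^bsub>G\<^esub> (proj y)" "proj x"]
  by (simp add: proj_mult proj_inv)

lemma sb_dot_eq:
  assumes "a \<in> carrier B" "b \<in> carrier B"
  shows "sb_dot B a b = act a (proj b) \<otimes>\<^bsub>G\<^esub> inv\<^bsub>G\<^esub> (proj b)"
proof -
  let ?x = "lam a (inv a) \<boxplus> a \<otimes> b"
  have x: "?x \<in> carrier B" using assms by (simp add: sadd_closed)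
  have "sb_dot B a b = ?x \<boxplus> lam b (inv b)" by (simp add: sb_dot_def)
  also have "\<dots> = proj ?x \<boxplus> lam b (inv b)"
    using x assms sadd_assoc[of ?x \<one> "lam b (inv b)"] by (simp add: proj_def)
  also have "proj ?x = act a (proj b)"
    using assms neg_in_G[of a] proj_sadd[of "lam a (inv a)" "a \<otimes> b"]
    by (simp add: proj_G neg_eq_inv[symmetric]) (simp add: proj_mult neg_eq_inv G_simps)
  finally show ?thesis using assms by (simp add: neg_eq_inv mult_G)
qed

section \<open>Ideals containing the idempotents\<close>

text \<open>The preimage of a subset of \<open>G\<close> under \<open>\<pi>\<close>.\<close>

definition lift :: "'a set \<Rightarrow> 'a set" where
  "lift N = {b \<in> carrier B. proj b \<in> N}"

lemma idempotents_eq_lift: "E = lift {\<one>}"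
  by (simp add: idempotents_eq lift_def)

lemma sb_add_set_eq_lift:
  assumes "N \<subseteq> carrier G" shows "sb_add_set B N E = lift N"
proof
  show "sb_add_set B N E \<subseteq> lift N"
  proof
    fix z assume "z \<in> sb_add_set B N E"
    then obtain x y where z: "z = x \<boxplus> y" and x: "x \<in> N" and y: "y \<in> E"
      by (auto simp: sb_add_set_def)
    have xG: "x \<in> carrier G" using assms x by auto
    have "proj z = x"
      using z xG y G.r_one[OF xG] by (simp add: proj_sadd G_into_B idempotents_eq proj_G one_G)
    then show "z \<in> lift N"
      using z x y xG by (simp add: lift_def sadd_closed G_into_B idempotents_eq)
  qed
  show "lift N \<subseteq> sb_add_set B N E"
  proof
    fix b assume b: "b \<in> lift N"
    then have bB: "b \<in> carrier B" and "proj b \<in> N" by (auto simp: lift_def)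
    define e where "e = lam b (inv b) \<boxplus> b"
    have e: "e \<in> E"
      using bB by (simp add: e_def idempotents_eq proj_sadd sadd_closed neg_eq_inv proj_G one_G G_into_B)
    have "proj b \<boxplus> e = (b \<boxplus> lam b (inv b)) \<boxplus> b"
      using bB by (simp add: e_def proj_def sadd_assoc sadd_closed)
    then have "proj b \<boxplus> e = b" using bB by (simp add: sadd_neg)
    then show "b \<in> sb_add_set B N E"
      unfolding sb_add_set_def using e \<open>proj b \<in> N\<close> by (smt (verit) mem_Collect_eq)
  qed
qed

text \<open>
  A normal subgroup of \<open>G\<close> is admissible if it is stable under the action of \<open>B\<close> and if its preimage
  acts trivially on the quotient of \<open>G\<close> by it. These are the subgroups \<open>I \<inter> G\<close> for the ideals \<open>I \<supseteq> E\<close>.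
\<close>

definition admissible :: "'a set \<Rightarrow> bool" where
  "admissible N \<longleftrightarrow> N \<lhd> G \<and> (\<forall>a\<in>carrier B. \<forall>n\<in>N. act a n \<in> N) \<and>
     (\<forall>a\<in>lift N. \<forall>g\<in>carrier G. act a g \<otimes>\<^bsub>G\<^esub> inv\<^bsub>G\<^esub> g \<in> N)"

lemma admissible_normal: "admissible N \<Longrightarrow> N \<lhd> G"
  and admissible_act: "\<lbrakk>admissible N; a \<in> carrier B; n \<in> N\<rbrakk> \<Longrightarrow> act a n \<in> N"
  and admissible_act_diff:
    "\<lbrakk>admissible N; a \<in> lift N; g \<in> carrier G\<rbrakk> \<Longrightarrow> act a g \<otimes>\<^bsub>G\<^esub> inv\<^bsub>G\<^esub> g \<in> N"
  by (auto simp: admissible_def)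

lemma admissible_subgroup: "admissible N \<Longrightarrow> subgroup N G"
  by (simp add: admissible_normal normal_imp_subgroup)

lemma lift_into_B: "b \<in> lift N \<Longrightarrow> b \<in> carrier B"
  by (simp add: lift_def)

text \<open>Left cosets of \<open>\<pi>\<^sup>-\<^sup>1(N)\<close> in \<open>(B, \<circ>)\<close> are the preimages of the cosets of \<open>N\<close> in \<open>G\<close>.\<close>

lemma inv_mult_in_lift_iff:
  assumes N: "admissible N" and x: "x \<in> carrier B" and y: "y \<in> carrier B"
  shows "inv y \<otimes> x \<in> lift N \<longleftrightarrow> proj x \<otimes>\<^bsub>G\<^esub> inv\<^bsub>G\<^esub> (proj y) \<in> N"
proof -
  interpret N: normal N G by (rule admissible_normal[OF N])
  let ?u = "inv\<^bsub>G\<^esub> (proj y) \<otimes>\<^bsub>G\<^esub> proj x"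
  have "act (inv y) ?u \<in> N \<longleftrightarrow> ?u \<in> N"
    using admissible_act[OF N, of y "act (inv y) ?u"] admissible_act[OF N, of "inv y" ?u] x y
    by auto
  also have "\<dots> \<longleftrightarrow> proj x \<otimes>\<^bsub>G\<^esub> inv\<^bsub>G\<^esub> (proj y) \<in> N"
    using N.inv_op_closed2[of "proj y" ?u]
      N.inv_op_closed1[of "proj y" "proj x \<otimes>\<^bsub>G\<^esub> inv\<^bsub>G\<^esub> (proj y)"] x y
    by (auto simp: G_simps)
  finally show ?thesis using x y by (simp add: lift_def proj_inv_mult)
qed

lemma lift_normal:
  assumes N: "admissible N" shows "lift N \<lhd> B"
proof -
  interpret N: normal N G by (rule admissible_normal[OF N])
  have sub: "subgroup (lift N) B"
  proof (rule subgroupI)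
    show "lift N \<subseteq> carrier B" by (auto simp: lift_def)
    show "lift N \<noteq> {}" using N.one_closed by (auto simp: lift_def one_G intro!: exI[of _ \<one>])
    show "inv a \<in> lift N" if "a \<in> lift N" for a
      using that by (auto simp: lift_def proj_inv admissible_act[OF N])
    show "a \<otimes> b \<in> lift N" if "a \<in> lift N" "b \<in> lift N" for a b
      using that by (auto simp: lift_def proj_mult admissible_act[OF N])
  qed
  have "inv x \<otimes> h \<otimes> x \<in> lift N" if x: "x \<in> carrier B" and h: "h \<in> lift N" for x h
  proof -
    have hB: "h \<in> carrier B" and hN: "proj h \<in> N" using h by (auto simp: lift_def)
    have "proj (h \<otimes> x) \<otimes>\<^bsub>G\<^esub> inv\<^bsub>G\<^esub> (proj x)
        = proj h \<otimes>\<^bsub>G\<^esub> (act h (proj x) \<otimes>\<^bsub>G\<^esub> inv\<^bsub>G\<^esub> (proj x))"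
      using x hB by (simp add: proj_mult G_simps)
    also have "\<dots> \<in> N" using hN admissible_act_diff[OF N h] x by simp
    finally show ?thesis
      using inv_mult_in_lift_iff[OF N, of "h \<otimes> x" x] x hB by (simp add: m_assoc)
  qed
  then have "x \<otimes> h \<otimes> inv x \<in> lift N" if "x \<in> carrier B" "h \<in> lift N" for x h
    using that inv_closed[of x] inv_inv[of x] by metis
  then show ?thesis by (simp add: normal_inv_iff sub)
qed

lemma lift_inter_G: "N \<subseteq> carrier G \<Longrightarrow> lift N \<inter> carrier G = N"
  by (auto simp: lift_def carrier_G)

lemma lift_ideal:
  assumes N: "admissible N" shows "sb_ideal (lift N) B"
proof -
  interpret N: normal N G by (rule admissible_normal[OF N])
  interpret I: normal "lift N" B by (rule lift_normal[OF N])
  \<comment> \<open>As a simplification rule it loops together with the definition of \<open>lift\<close>.\<close>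
  note I.mem_carrier [simp del]
  have "sb_rho B b n \<in> lift N" if b: "b \<in> carrier B" and n: "n \<in> lift N" for b n
  proof -
    have nB: "n \<in> carrier B" using n by (rule lift_into_B)
    have "proj (inv n) \<in> N" using I.m_inv_closed[OF n] by (simp add: lift_def)
    then have "inv b \<otimes> (inv n \<boxplus> b) \<in> lift N"
      using b nB by (simp add: inv_mult_in_lift_iff[OF N] sadd_closed proj_sadd G_simps)
    then have "inv (inv b \<otimes> (inv n \<boxplus> b)) \<in> lift N" by simp
    then show ?thesis using b nB by (simp add: sb_rho_def inv_mult_group sadd_closed)
  qed
  moreover have "lam g e \<in> lift N" if g: "g \<in> carrier B" and e: "e \<in> lift N" for g e
    using g e admissible_act[OF N] by (auto simp: lift_def proj_lam)
  moreover have "x \<boxplus> y \<in> lift N" if "x \<in> lift N" "y \<in> lift N" for x y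
    using that by (auto simp: lift_def proj_sadd sadd_closed)
  moreover have "N \<subseteq> lift N" using lift_inter_G[OF N.subset] by blast
  ultimately show ?thesis
    using N.normal_axioms I.normal_axioms I.subset
    by (auto simp: sb_ideal_def lift_inter_G[OF N.subset] dest: G_into_B)
qed

lemma ideal_eq_lift:
  assumes I: "sb_ideal I B" and E: "E \<subseteq> I"
  shows "lift (I \<inter> carrier G) = I"
proof -
  interpret I: normal I B using I by (simp add: sb_ideal_def)
  note I.mem_carrier [simp del]
  have IG: "I \<inter> carrier G \<subseteq> carrier G" by auto
  have add: "x \<boxplus> y \<in> I" if "x \<in> I" "y \<in> I" for x y using I that by (simp add: sb_ideal_def)
  have "proj x \<in> I" if "x \<in> I" for x using add[OF that I.one_closed] by (simp add: proj_def)
  then have "I \<subseteq> lift (I \<inter> carrier G)" using I.subset by (auto simp: lift_def)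
  moreover have "lift (I \<inter> carrier G) \<subseteq> I"
    unfolding sb_add_set_eq_lift[OF IG, symmetric] using add E by (auto simp: sb_add_set_def)
  ultimately show ?thesis by auto
qed

lemma idempotents_inv: assumes "e \<in> E" shows "inv e \<in> E"
  using assms G.one_closed hom_one[OF act_hom G.group_axioms G.group_axioms, of "inv e"]
  by (auto simp: idempotents_eq proj_inv G.inv_one[unfolded one_G] one_G)

text \<open>
  Every coset of the subgroup \<open>E\<close> of \<open>(B, \<circ>)\<close> meets \<open>G\<close>. This is needed because the condition on
  \<open>\<rho>\<close> in the definition of an ideal only concerns elements of \<open>G\<close>.
\<close>

lemma ex_idempotent_mult_in_G:
  assumes x: "x \<in> carrier B" shows "\<exists>e\<in>E. e \<otimes> x \<in> carrier G"
proof -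
  \<comment> \<open>\<open>f\<close> is the idempotent component of \<open>x = \<pi>(x) + f\<close>, and \<open>\<lambda>\<close> of its inverse moves \<open>f\<close> to \<open>0\<close>.\<close>
  define f where "f = lam x (inv x) \<boxplus> x"
  have f: "f \<in> E" and fB: "f \<in> carrier B"
    using x
    by (auto simp: f_def idempotents_eq proj_sadd sadd_closed neg_eq_inv proj_G one_G[symmetric] G_into_B)
  have xf: "x \<boxplus> f = x"
    using x sadd_assoc[of x "lam x (inv x)" x] by (simp add: f_def sadd_neg)
  have f1: "lam (inv f) f = \<one>"
    using f fB by (simp add: sb_lambda_def sb_idempotents_def)
  have f_left: "inv f \<boxplus> y = y" if "y \<in> carrier B" for y
  proof -
    have "inv f \<boxplus> \<one> = \<one>" using idempotents_inv[OF f] by (simp add: idempotents_eq proj_def)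
    then show ?thesis using that fB sadd_assoc[of "inv f" \<one> y] by simp
  qed
  have "inv f \<otimes> x = lam (inv f) x" using x fB by (simp add: mult_eq_sadd f_left)
  moreover have "proj (lam (inv f) x) = lam (inv f) x"
    using lam_sadd[of "inv f" x f] x fB by (simp add: proj_def xf f1)
  ultimately show ?thesis using idempotents_inv[OF f] x fB by (intro bexI[of _ "inv f"]) (simp_all add: carrier_G)
qed

text \<open>
  The condition \<open>\<rho>\<^sub>b(n) \<in> I\<close> says that \<open>n\<^sup>- + b\<close> lies in \<open>b \<circ> I\<close>. It yields stability under the action
  once \<open>n\<close> is chosen such that \<open>\<pi>(n\<^sup>-)\<close> is a prescribed element of \<open>I \<inter> G\<close>. Triviality of the action of
  \<open>I\<close> modulo \<open>I \<inter> G\<close> then follows from the normality of \<open>I\<close> in \<open>(B, \<circ>)\<close>.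
\<close>

lemma ideal_admissible:
  assumes I: "sb_ideal I B" and E: "E \<subseteq> I"
  shows "admissible (I \<inter> carrier G)"
proof -
  define N where "N = I \<inter> carrier G"
  have NG: "N \<lhd> G" and IB: "I \<lhd> B" using I by (auto simp: sb_ideal_def N_def)
  interpret N: normal N G by (rule NG)
  interpret I: normal I B by (rule IB)
  note I.mem_carrier [simp del]
  have I_eq: "I = lift N" using ideal_eq_lift[OF I E] by (simp add: N_def)
  have IN: "i \<in> carrier B \<and> proj i \<in> N" if "i \<in> I" for i using that by (simp add: I_eq lift_def)
  have act_inv: "act (inv b) m \<in> N" if b: "b \<in> carrier B" and m: "m \<in> N" for b m
  proof -
    \<comment> \<open>Conjugation by \<open>\<pi>(b)\<close> compensates for \<open>k\<close> being added to \<open>b\<close> on the left.\<close>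
    define k where "k = proj b \<otimes>\<^bsub>G\<^esub> m \<otimes>\<^bsub>G\<^esub> inv\<^bsub>G\<^esub> (proj b)"
    have k: "k \<in> N" using N.inv_op_closed2 b m by (simp add: k_def)
    have kB: "k \<in> carrier B" and kI: "k \<in> I" and pk: "proj k = k"
      using k by (auto simp: N_def carrier_G)
    obtain e where e: "e \<in> E" and eG: "e \<otimes> inv k \<in> carrier G"
      using ex_idempotent_mult_in_G[of "inv k"] kB by auto
    have eB: "e \<in> carrier B" and e': "inv e \<in> E"
      using e idempotents_inv by (auto simp: idempotents_eq)
    define n where "n = e \<otimes> inv k"
    have nB: "n \<in> carrier B" using eB kB by (simp add: n_def)
    have n: "n \<in> I \<inter> carrier G" using e E eG kI by (auto simp: n_def)
    have "inv n = k \<otimes> inv e" using eB kB by (simp add: n_def inv_mult_group)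
    then have pn: "proj (inv n) = k"
      using e' eB kB pk N.mem_carrier[OF k] hom_one[OF act_hom G.group_axioms G.group_axioms, of k]
      by (simp add: proj_mult idempotents_eq one_G[symmetric])
    have "sb_rho B b n \<in> I" using I b n by (auto simp: sb_ideal_def)
    then have "inv (inv (inv n \<boxplus> b) \<otimes> b) \<in> I" by (simp add: sb_rho_def)
    then have "inv b \<otimes> (inv n \<boxplus> b) \<in> I" using b nB by (simp add: inv_mult_group sadd_closed)
    then have "proj (inv b \<otimes> (inv n \<boxplus> b)) \<in> N" using IN by blast
    then show ?thesis
      using b nB m by (simp add: proj_inv_mult sadd_closed proj_sadd pn k_def G_simps)
  qed
  have act: "act b m \<in> N" if "b \<in> carrier B" "m \<in> N" for b m
    using act_inv[of "inv b" m] that by simp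
  have "act a g \<otimes>\<^bsub>G\<^esub> inv\<^bsub>G\<^esub> g \<in> N" if a: "a \<in> I" and g: "g \<in> carrier G" for a g
  proof -
    have aB: "a \<in> carrier B" and gB: "g \<in> carrier B" and aN: "proj a \<in> N"
      using IN a g by (auto simp: G_into_B)
    have "inv g \<otimes> (a \<otimes> g) \<in> I" using I.inv_op_closed1[OF gB a] aB gB by (simp add: m_assoc)
    then have "proj (inv g \<otimes> (a \<otimes> g)) \<in> N" using IN by blast
    then have "act g (proj (inv g \<otimes> (a \<otimes> g))) \<in> N" using act gB by blast
    moreover have "proj (inv g \<otimes> (a \<otimes> g))
        = act (inv g) (inv\<^bsub>G\<^esub> g \<otimes>\<^bsub>G\<^esub> (proj a \<otimes>\<^bsub>G\<^esub> act a g))"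
      using aB gB g by (subst proj_inv_mult) (simp_all add: proj_mult proj_G)
    ultimately have "inv\<^bsub>G\<^esub> g \<otimes>\<^bsub>G\<^esub> (proj a \<otimes>\<^bsub>G\<^esub> act a g) \<in> N"
      using aB gB g by simp
    then have "g \<otimes>\<^bsub>G\<^esub> (inv\<^bsub>G\<^esub> g \<otimes>\<^bsub>G\<^esub> (proj a \<otimes>\<^bsub>G\<^esub> act a g)) \<otimes>\<^bsub>G\<^esub> inv\<^bsub>G\<^esub> g \<in> N"
      using N.inv_op_closed2[OF g] by blast
    then have "proj a \<otimes>\<^bsub>G\<^esub> (act a g \<otimes>\<^bsub>G\<^esub> inv\<^bsub>G\<^esub> g) \<in> N"
      using aB g by (simp add: G_simps)
    from N.m_closed[OF N.m_inv_closed[OF aN] this] show ?thesis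
      using aB g by (simp add: G.inv_cancel)
  qed
  then show ?thesis using act NG by (simp add: admissible_def I_eq[symmetric] N_def[symmetric])
qed

section \<open>Quotients and their socles\<close>

lemma coset_eq_iff:
  assumes N: "admissible N" and x: "x \<in> carrier B" and y: "y \<in> carrier B"
  shows "lift N #> x = lift N #> y \<longleftrightarrow> proj x \<otimes>\<^bsub>G\<^esub> inv\<^bsub>G\<^esub> (proj y) \<in> N"
proof -
  have I: "lift N \<lhd> B" and sub: "subgroup (lift N) B"
    using lift_normal[OF N] by (auto simp: normal_imp_subgroup)
  have "lift N #> x = lift N #> y \<longleftrightarrow> x \<in> lift N #> y"
    using repr_independence[OF _ y sub] rcos_self[OF x sub] by auto
  also have "\<dots> \<longleftrightarrow> x \<in> y <# lift N"
    using normal.coset_eq[OF I] y by auto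
  also have "\<dots> \<longleftrightarrow> inv y \<otimes> x \<in> lift N"
  proof
    assume "x \<in> y <# lift N"
    then obtain j where "j \<in> lift N" "x = y \<otimes> j" by (auto simp: l_coset_def)
    then show "inv y \<otimes> x \<in> lift N" using y lift_into_B[of j N] by (simp add: m_assoc[symmetric])
  next
    assume "inv y \<otimes> x \<in> lift N"
    moreover have "x = y \<otimes> (inv y \<otimes> x)" using x y by (simp add: m_assoc[symmetric])
    ultimately show "x \<in> y <# lift N" unfolding l_coset_def by blast
  qed
  finally show ?thesis using inv_mult_in_lift_iff[OF N x y] by simp
qed

lemma coset_in_carrier_quotient:
  "x \<in> carrier B \<Longrightarrow> lift N #> x \<in> carrier (sb_quotient B (lift N))"
  by (auto simp: sb_quotient_def FactGroup_def RCOSETS_def)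

lemma carrier_quotientE:
  assumes "X \<in> carrier (sb_quotient B (lift N))"
  obtains x where "x \<in> carrier B" "X = lift N #> x"
  using assms by (auto simp: sb_quotient_def FactGroup_def RCOSETS_def)

lemma mult_quotient:
  assumes "admissible N" "x \<in> carrier B" "y \<in> carrier B"
  shows "(lift N #> x) \<otimes>\<^bsub>sb_quotient B (lift N)\<^esub> (lift N #> y) = lift N #> (x \<otimes> y)"
  using normal.rcos_sum[OF lift_normal] assms by (simp add: sb_quotient_def FactGroup_def)

lemma inv_quotient:
  assumes N: "admissible N" and x: "x \<in> carrier B"
  shows "inv\<^bsub>sb_quotient B (lift N)\<^esub> (lift N #> x) = lift N #> inv x"
proof -
  have "inv\<^bsub>sb_quotient B (lift N)\<^esub> (lift N #> x) = inv\<^bsub>B Mod lift N\<^esub> (lift N #> x)"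
    by (simp add: m_inv_def sb_quotient_def)
  also have "\<dots> = lift N #> inv x"
    using x normal.inv_FactGroup[OF lift_normal[OF N]] normal.rcos_inv[OF lift_normal[OF N]]
      coset_in_carrier_quotient[of x N]
    by (simp add: sb_quotient_def)
  finally show ?thesis .
qed

lemma one_quotient: "admissible N \<Longrightarrow> \<one>\<^bsub>sb_quotient B (lift N)\<^esub> = lift N #> \<one>"
  using coset_mult_one[of "lift N"] normal_imp_subgroup[OF lift_normal, THEN subgroup.subset]
  by (simp add: sb_quotient_def FactGroup_def)

lemma sadd_quotient:
  assumes N: "admissible N" and x: "x \<in> carrier B" and y: "y \<in> carrier B"
  shows "(lift N #> x) \<boxplus>\<^bsub>sb_quotient B (lift N)\<^esub> (lift N #> y) = lift N #> (x \<boxplus> y)"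
proof -
  interpret N: normal N G by (rule admissible_normal[OF N])
  have sub: "subgroup (lift N) B" using lift_normal[OF N] by (simp add: normal_imp_subgroup)
  have "lift N #> (u \<boxplus> v) = lift N #> (x \<boxplus> y)" if u: "u \<in> lift N #> x" and v: "v \<in> lift N #> y" for u v
  proof -
    have uB: "u \<in> carrier B" and vB: "v \<in> carrier B"
      using u v x y lift_into_B by (auto simp: r_coset_def)
    have nu: "proj u \<otimes>\<^bsub>G\<^esub> inv\<^bsub>G\<^esub> (proj x) \<in> N"
      using repr_independence[OF u x sub] coset_eq_iff[OF N uB x] by simp
    have nv: "proj v \<otimes>\<^bsub>G\<^esub> inv\<^bsub>G\<^esub> (proj y) \<in> N"
      using repr_independence[OF v y sub] coset_eq_iff[OF N vB y] by simp
    have "proj (u \<boxplus> v) \<otimes>\<^bsub>G\<^esub> inv\<^bsub>G\<^esub> (proj (x \<boxplus> y))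
        = (proj u \<otimes>\<^bsub>G\<^esub> (proj v \<otimes>\<^bsub>G\<^esub> inv\<^bsub>G\<^esub> (proj y)) \<otimes>\<^bsub>G\<^esub> inv\<^bsub>G\<^esub> (proj u)) \<otimes>\<^bsub>G\<^esub>
          (proj u \<otimes>\<^bsub>G\<^esub> inv\<^bsub>G\<^esub> (proj x))"
      using uB vB x y by (simp add: proj_sadd G_simps)
    also have "\<dots> \<in> N" using N.inv_op_closed2[OF _ nv, of "proj u"] nu uB by simp
    finally show ?thesis using coset_eq_iff[OF N, of "u \<boxplus> v" "x \<boxplus> y"] uB vB x y
      by (simp add: sadd_closed)
  qed
  then have "(\<Union>u\<in>lift N #> x. \<Union>v\<in>lift N #> y. lift N #> (u \<boxplus> v)) = lift N #> (x \<boxplus> y)"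
    using rcos_self[OF x sub] rcos_self[OF y sub] by blast
  then show ?thesis by (simp add: sb_quotient_def)
qed

lemma lam_quotient:
  assumes "admissible N" "a \<in> carrier B" "b \<in> carrier B"
  shows "sb_lambda (sb_quotient B (lift N)) (lift N #> a) (lift N #> b) = lift N #> lam a b"
  using assms by (simp add: sb_lambda_def inv_quotient sadd_quotient mult_quotient sadd_closed)

lemma rho_quotient:
  assumes "admissible N" "a \<in> carrier B" "b \<in> carrier B"
  shows "sb_rho (sb_quotient B (lift N)) (lift N #> b) (lift N #> a) = lift N #> sb_rho B b a"
  using assms by (simp add: sb_rho_def inv_quotient sadd_quotient mult_quotient sadd_closed)

text \<open>
  With \<open>c = b\<^sup>-\<close>, the equation \<open>\<rho>\<^sub>a(b) = \<rho>\<^sub>0(b)\<close> in the quotient amounts to \<open>a \<circ> (c + 0) = c + a\<close>. If \<open>a\<close>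
  acts trivially, the left-hand side is \<open>a + c\<close> up to idempotents, so commutation suffices.
\<close>

lemma coset_in_socleI:
  assumes N: "admissible N" and a: "a \<in> carrier B"
    and triv: "\<And>g. g \<in> carrier G \<Longrightarrow> act a g \<otimes>\<^bsub>G\<^esub> inv\<^bsub>G\<^esub> g \<in> N"
    and comm: "\<And>g. g \<in> carrier G \<Longrightarrow>
      proj a \<otimes>\<^bsub>G\<^esub> g \<otimes>\<^bsub>G\<^esub> inv\<^bsub>G\<^esub> (proj a) \<otimes>\<^bsub>G\<^esub> inv\<^bsub>G\<^esub> g \<in> N"
  shows "lift N #> a \<in> sb_socle (sb_quotient B (lift N))"
proof -
  interpret N: normal N G by (rule admissible_normal[OF N])
  let ?Q = "sb_quotient B (lift N)"
  have lam: "lift N #> lam a b = lift N #> lam \<one> b" if "b \<in> carrier B" for b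
    using that a triv by (simp add: coset_eq_iff[OF N] proj_lam)
  have rho: "lift N #> sb_rho B a b = lift N #> sb_rho B \<one> b" if b: "b \<in> carrier B" for b
  proof -
    define c where "c = inv b"
    have c: "c \<in> carrier B" using b by (simp add: c_def)
    have ca: "c \<boxplus> a \<in> carrier B" and c1: "c \<boxplus> \<one> \<in> carrier B" using a c by (auto simp: sadd_closed)
    have "proj (a \<otimes> (c \<boxplus> \<one>)) \<otimes>\<^bsub>G\<^esub> inv\<^bsub>G\<^esub> (proj (c \<boxplus> a))
        = (proj a \<otimes>\<^bsub>G\<^esub> (act a (proj c) \<otimes>\<^bsub>G\<^esub> inv\<^bsub>G\<^esub> (proj c)) \<otimes>\<^bsub>G\<^esub> inv\<^bsub>G\<^esub> (proj a)) \<otimes>\<^bsub>G\<^esub>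
          (proj a \<otimes>\<^bsub>G\<^esub> proj c \<otimes>\<^bsub>G\<^esub> inv\<^bsub>G\<^esub> (proj a) \<otimes>\<^bsub>G\<^esub> inv\<^bsub>G\<^esub> (proj c))"
      using a c G.r_one[of "proj c"] by (simp add: proj_mult proj_sadd c1 G_simps one_G)
    also have "\<dots> \<in> N"
      using comm[of "proj c"] N.inv_op_closed2[OF _ triv[of "proj c"], of "proj a"] a c by simp
    finally have eq: "lift N #> (a \<otimes> (c \<boxplus> \<one>)) = lift N #> (c \<boxplus> a)"
      using coset_eq_iff[OF N, of "a \<otimes> (c \<boxplus> \<one>)" "c \<boxplus> a"] a c1 ca by simp
    have "lift N #> sb_rho B a b = lift N #> (inv (c \<boxplus> a) \<otimes> (a \<otimes> (c \<boxplus> \<one>)) \<otimes> inv (c \<boxplus> \<one>))"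
      using a c1 ca by (simp add: sb_rho_def c_def[symmetric] m_assoc)
    also have "\<dots> = (lift N #> inv (c \<boxplus> a)) \<otimes>\<^bsub>?Q\<^esub> (lift N #> (c \<boxplus> a)) \<otimes>\<^bsub>?Q\<^esub> (lift N #> inv (c \<boxplus> \<one>))"
      using a c1 ca by (simp add: mult_quotient[OF N, symmetric] eq)
    also have "\<dots> = lift N #> sb_rho B \<one> b"
      using c1 ca by (simp add: mult_quotient[OF N] sb_rho_def c_def[symmetric])
    finally show ?thesis .
  qed
  show ?thesis
    unfolding sb_socle_def one_quotient[OF N]
    using coset_in_carrier_quotient[OF a]
    by (auto elim!: carrier_quotientE simp: rho_quotient[OF N] lam_quotient[OF N] a lam rho
        simp del: lam_one)
qed

lemma coset_in_socleD:
  assumes N: "admissible N" and a: "a \<in> carrier B"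
    and soc: "lift N #> a \<in> sb_socle (sb_quotient B (lift N))" and g: "g \<in> carrier G"
  shows "act a g \<otimes>\<^bsub>G\<^esub> inv\<^bsub>G\<^esub> g \<in> N"
proof -
  have gB: "g \<in> carrier B" using g by (rule G_into_B)
  have "lift N #> lam a g = lift N #> lam \<one> g"
    using soc coset_in_carrier_quotient[OF gB, of N] a gB
    by (auto simp: sb_socle_def one_quotient[OF N] lam_quotient[OF N, symmetric] simp del: lam_one)
  then show ?thesis using a g gB by (simp add: coset_eq_iff[OF N] proj_lam proj_G)
qed

section \<open>The right series\<close>

text \<open>The subgroup of \<open>G\<close> generated by all \<open>a \<cdot> b\<close> with \<open>\<pi>(a) \<in> N\<close> and \<open>b \<in> B\<close> (see \<open>sb_dot_set_lift\<close>).\<close>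

definition dot_closure :: "'a set \<Rightarrow> 'a set" where
  "dot_closure N = generate G {act a g \<otimes>\<^bsub>G\<^esub> inv\<^bsub>G\<^esub> g | a g. a \<in> lift N \<and> g \<in> carrier G}"

lemma sb_dot_set_lift: "sb_dot_set B (lift N) (carrier B) = dot_closure N"
proof -
  have "{sb_dot B x y |x y. x \<in> lift N \<and> y \<in> carrier B}
      = {act a g \<otimes>\<^bsub>G\<^esub> inv\<^bsub>G\<^esub> g | a g. a \<in> lift N \<and> g \<in> carrier G}" (is "?L = ?R")
  proof
    show "?L \<subseteq> ?R" using lift_into_B by (fastforce simp: sb_dot_eq)
    show "?R \<subseteq> ?L"
    proof
      fix z assume "z \<in> ?R"
      then obtain a g where z: "z = act a g \<otimes>\<^bsub>G\<^esub> inv\<^bsub>G\<^esub> g" "a \<in> lift N" "g \<in> carrier G" by auto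
      then have "z = sb_dot B a g" using lift_into_B[of a N] by (simp add: sb_dot_eq G_into_B proj_G)
      then show "z \<in> ?L" using z G_into_B by blast
    qed
  qed
  then show ?thesis by (simp add: sb_dot_set_def dot_closure_def)
qed

lemma dot_closure_gens: "{act a g \<otimes>\<^bsub>G\<^esub> inv\<^bsub>G\<^esub> g | a g. a \<in> lift N \<and> g \<in> carrier G} \<subseteq> carrier G"
  using lift_into_B by auto

lemma dot_closure_subgroup: "subgroup (dot_closure N) G"
  unfolding dot_closure_def by (rule G.generate_is_subgroup[OF dot_closure_gens])

lemma dot_closure_subset_iff:
  "subgroup M G \<Longrightarrow> dot_closure N \<subseteq> M \<longleftrightarrow>
    (\<forall>a\<in>lift N. \<forall>g\<in>carrier G. act a g \<otimes>\<^bsub>G\<^esub> inv\<^bsub>G\<^esub> g \<in> M)"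
proof
  assume "dot_closure N \<subseteq> M"
  then show "\<forall>a\<in>lift N. \<forall>g\<in>carrier G. act a g \<otimes>\<^bsub>G\<^esub> inv\<^bsub>G\<^esub> g \<in> M"
    unfolding dot_closure_def by (blast intro: generate.incl)
next
  assume "subgroup M G" "\<forall>a\<in>lift N. \<forall>g\<in>carrier G. act a g \<otimes>\<^bsub>G\<^esub> inv\<^bsub>G\<^esub> g \<in> M"
  then show "dot_closure N \<subseteq> M"
    unfolding dot_closure_def by (intro G.generate_subgroup_incl) auto
qed

lemma dot_closure_mono: "M \<subseteq> N \<Longrightarrow> dot_closure M \<subseteq> dot_closure N"
  unfolding dot_closure_def by (rule G.mono_generate) (auto simp: lift_def)

lemma admissible_iff:
  "admissible N \<longleftrightarrow> N \<lhd> G \<and> (\<forall>a\<in>carrier B. act a ` N \<subseteq> N) \<and> dot_closure N \<subseteq> N"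
  using dot_closure_subset_iff[of N N] normal_imp_subgroup[of N G]
  by (auto simp: admissible_def image_subset_iff)

text \<open>
  Normality comes from \<open>a \<cdot> (k + g) = a \<cdot> k + (k + a \<cdot> g - k)\<close>, and stability from
  \<open>act b (a \<cdot> g) = (b \<circ> a \<circ> b\<^sup>-) \<cdot> act b g\<close> together with the normality of \<open>\<pi>\<^sup>-\<^sup>1(N)\<close> in \<open>(B, \<circ>)\<close>.
\<close>

lemma admissible_dot_closure:
  assumes N: "admissible N" shows "admissible (dot_closure N)"
proof -
  let ?S = "{act a g \<otimes>\<^bsub>G\<^esub> inv\<^bsub>G\<^esub> g | a g. a \<in> lift N \<and> g \<in> carrier G}"
  have S: "?S \<subseteq> carrier G" by (rule dot_closure_gens)
  have I: "lift N \<lhd> B" by (rule lift_normal[OF N])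
  interpret D: subgroup "dot_closure N" G by (rule dot_closure_subgroup)
  have gen: "act a g \<otimes>\<^bsub>G\<^esub> inv\<^bsub>G\<^esub> g \<in> dot_closure N" if "a \<in> lift N" "g \<in> carrier G" for a g
    using that unfolding dot_closure_def by (blast intro: generate.incl)
  have conj: "(\<lambda>x. k \<otimes>\<^bsub>G\<^esub> x \<otimes>\<^bsub>G\<^esub> inv\<^bsub>G\<^esub> k) ` dot_closure N \<subseteq> dot_closure N" if k: "k \<in> carrier G" for k
    unfolding dot_closure_def
  proof (rule G.hom_image_generate_subset[OF G.conj_hom[OF k] S], unfold dot_closure_def[symmetric], safe)
    fix a g assume a: "a \<in> lift N" and g: "g \<in> carrier G"
    have aB: "a \<in> carrier B" using a by (rule lift_into_B)
    have "act a (k \<otimes>\<^bsub>G\<^esub> g) = act a k \<otimes>\<^bsub>G\<^esub> act a g" by (rule hom_mult[OF act_hom[OF aB] k g])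
    then have "k \<otimes>\<^bsub>G\<^esub> (act a g \<otimes>\<^bsub>G\<^esub> inv\<^bsub>G\<^esub> g) \<otimes>\<^bsub>G\<^esub> inv\<^bsub>G\<^esub> k
       = inv\<^bsub>G\<^esub> (act a k \<otimes>\<^bsub>G\<^esub> inv\<^bsub>G\<^esub> k) \<otimes>\<^bsub>G\<^esub> (act a (k \<otimes>\<^bsub>G\<^esub> g) \<otimes>\<^bsub>G\<^esub> inv\<^bsub>G\<^esub> (k \<otimes>\<^bsub>G\<^esub> g))"
      using aB k g by (simp add: G_simps)
    also have "\<dots> \<in> dot_closure N" using gen[OF a k] gen[OF a, of "k \<otimes>\<^bsub>G\<^esub> g"] k g by simp
    finally show "k \<otimes>\<^bsub>G\<^esub> (act a g \<otimes>\<^bsub>G\<^esub> inv\<^bsub>G\<^esub> g) \<otimes>\<^bsub>G\<^esub> inv\<^bsub>G\<^esub> k \<in> dot_closure N" .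
  qed
  have "act b ` dot_closure N \<subseteq> dot_closure N" if b: "b \<in> carrier B" for b
    unfolding dot_closure_def
  proof (rule G.hom_image_generate_subset[OF act_hom[OF b] S], unfold dot_closure_def[symmetric], safe)
    fix a g assume a: "a \<in> lift N" and g: "g \<in> carrier G"
    have aB: "a \<in> carrier B" using a by (rule lift_into_B)
    interpret ab: group_hom G G "act b"
      by (simp add: group_hom_def group_hom_axioms_def act_hom b G.group_axioms)
    have "act (b \<otimes> a \<otimes> inv b) (act b g) = act b (act a g)"
      using aB b g by (simp add: act_mult)
    then have "act b (act a g \<otimes>\<^bsub>G\<^esub> inv\<^bsub>G\<^esub> g)
        = act (b \<otimes> a \<otimes> inv b) (act b g) \<otimes>\<^bsub>G\<^esub> inv\<^bsub>G\<^esub> (act b g)"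
      using aB b g by simp
    also have "\<dots> \<in> dot_closure N"
      using gen[OF normal.inv_op_closed2[OF I b a], of "act b g"] b g by simp
    finally show "act b (act a g \<otimes>\<^bsub>G\<^esub> inv\<^bsub>G\<^esub> g) \<in> dot_closure N" .
  qed
  moreover have "dot_closure N \<lhd> G"
    using conj dot_closure_subgroup by (auto simp: G.normal_inv_iff)
  moreover have "dot_closure (dot_closure N) \<subseteq> dot_closure N"
    using N dot_closure_mono by (auto simp: admissible_iff)
  ultimately show ?thesis by (simp add: admissible_iff)
qed

lemma admissible_G: "admissible (carrier G)"
  using lift_into_B by (auto simp: admissible_def G.normal_inv_iff G.subgroup_self)

lemma admissible_funpow_dot_closure: "admissible ((dot_closure ^^ n) (carrier G))"
  by (induction n) (simp_all add: admissible_G admissible_dot_closure)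

lemma lift_G: "lift (carrier G) = carrier B"
  by (auto simp: lift_def)

lemma right_series_eq: "sb_right_series B (Suc n) = lift ((dot_closure ^^ n) (carrier G))"
proof (induction n)
  case (Suc n)
  then show ?case
    using subgroup.subset[OF dot_closure_subgroup] by (simp add: sb_dot_set_lift sb_add_set_eq_lift)
qed (simp add: lift_G)

lemma right_nilpotent_iff: "sb_right_nilpotent B \<longleftrightarrow> (\<exists>n. (dot_closure ^^ n) (carrier G) = {\<one>})"
proof -
  have sub: "(dot_closure ^^ n) (carrier G) \<subseteq> carrier G" for n
    using admissible_subgroup[OF admissible_funpow_dot_closure] subgroup.subset by blast
  have "lift ((dot_closure ^^ n) (carrier G)) = E \<longleftrightarrow> (dot_closure ^^ n) (carrier G) = {\<one>}" for n
    using lift_inter_G[OF sub[of n]] lift_inter_G[of "{\<one>}"] G.one_closed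
    by (auto simp: idempotents_eq_lift one_G)
  then show ?thesis
    unfolding sb_right_nilpotent_def
    by (metis One_nat_def Suc_le_D le_numeral_extra(4) right_series_eq Suc_le_mono le0)
qed

section \<open>Refining the right series by the lower central series\<close>

text \<open>
  \<open>central_step N M\<close> says that \<open>N\<close> and \<open>M\<close> are admissible, \<open>M \<subseteq> N\<close>, and the preimage of \<open>N\<close> is mapped
  into the socle of the quotient by the preimage of \<open>M\<close>: it acts trivially on \<open>G/M\<close>, and \<open>N/M\<close> is central in
  \<open>G/M\<close>.
\<close>

definition central_step :: "'a set \<Rightarrow> 'a set \<Rightarrow> bool" where
  "central_step N M \<longleftrightarrow> admissible N \<and> admissible M \<and> M \<subseteq> N \<and> dot_closure N \<subseteq> M \<and>
     (\<forall>n\<in>N. \<forall>g\<in>carrier G. n \<otimes>\<^bsub>G\<^esub> g \<otimes>\<^bsub>G\<^esub> inv\<^bsub>G\<^esub> n \<otimes>\<^bsub>G\<^esub> inv\<^bsub>G\<^esub> g \<in> M)"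

text \<open>
  Between \<open>D(N)\<close> and \<open>N\<close> the triviality condition for admissibility is automatic, and
  normality and stability under the action both say that certain endomorphisms of \<open>G\<close> preserve \<open>L\<close>.
\<close>

lemma admissible_between:
  assumes "admissible N" and M: "admissible M" and "dot_closure N \<subseteq> M"
    and L: "subgroup L G" and inv: "\<And>h. \<lbrakk>h \<in> hom G G; h ` M \<subseteq> M; h ` N \<subseteq> N\<rbrakk> \<Longrightarrow> h ` L \<subseteq> L"
    and "M \<subseteq> L" "L \<subseteq> N"
  shows "admissible L"
  unfolding admissible_iff
proof (intro conjI ballI)
  have "g \<otimes>\<^bsub>G\<^esub> x \<otimes>\<^bsub>G\<^esub> inv\<^bsub>G\<^esub> g \<in> L" if "g \<in> carrier G" "x \<in> L" for g x
    using inv[OF G.conj_hom[OF that(1)]] that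
      normal.inv_op_closed2[OF admissible_normal[OF \<open>admissible N\<close>] that(1)]
      normal.inv_op_closed2[OF admissible_normal[OF M] that(1)] by blast
  then show "L \<lhd> G" using L by (simp add: G.normal_inv_iff)
  show "act a ` L \<subseteq> L" if "a \<in> carrier B" for a
    using inv[OF act_hom[OF that]] that assms(1,2) by (simp add: admissible_iff)
  show "dot_closure L \<subseteq> L"
    using dot_closure_mono[OF \<open>L \<subseteq> N\<close>] assms by blast
qed

text \<open>The subgroup \<open>N \<inter> (M + \<gamma>\<^sub>k(G))\<close>, with the lower central series starting at \<open>\<gamma>\<^sub>0(G) = G\<close>.\<close>

definition refinement :: "'a set \<Rightarrow> 'a set \<Rightarrow> nat \<Rightarrow> 'a set" where
  "refinement N M k = N \<inter> (M <#>\<^bsub>G\<^esub> lower_central G k)"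

lemma set_multI: "\<lbrakk>h \<in> H; k \<in> K\<rbrakk> \<Longrightarrow> h \<otimes>\<^bsub>G\<^esub> k \<in> H <#>\<^bsub>G\<^esub> K"
  unfolding set_mult_def by blast

lemma set_multE:
  assumes "x \<in> H <#>\<^bsub>G\<^esub> K" obtains h k where "h \<in> H" "k \<in> K" "x = h \<otimes>\<^bsub>G\<^esub> k"
  using assms by (auto simp: set_mult_def)

lemma set_mult_lower_central_subgroup:
  "M \<lhd> G \<Longrightarrow> subgroup (M <#>\<^bsub>G\<^esub> lower_central G k) G"
  using G.normal_subgroup_set_mult_closed[OF _ G.lower_central_normal]
  by (simp add: normal_imp_subgroup)

lemma subset_refinement:
  assumes "subgroup M G" "M \<subseteq> N" shows "M \<subseteq> refinement N M k"
proof
  fix m assume m: "m \<in> M"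
  have "m \<otimes>\<^bsub>G\<^esub> \<one>\<^bsub>G\<^esub> \<in> M <#>\<^bsub>G\<^esub> lower_central G k"
    using m subgroup.one_closed[OF G.lower_central_subgroup] by (rule set_multI)
  then show "m \<in> refinement N M k"
    using m assms subgroup.mem_carrier[OF assms(1) m] by (auto simp: refinement_def)
qed

lemma admissible_refinement:
  assumes N: "admissible N" and M: "admissible M" and "dot_closure N \<subseteq> M" "M \<subseteq> N"
  shows "admissible (refinement N M k)"
proof (rule admissible_between[OF N M \<open>dot_closure N \<subseteq> M\<close>])
  let ?C = "lower_central G k"
  interpret M: subgroup M G by (rule admissible_subgroup[OF M])
  interpret C: subgroup ?C G by (rule G.lower_central_subgroup)
  show "subgroup (refinement N M k) G"
    unfolding refinement_def
    using set_mult_lower_central_subgroup[OF admissible_normal[OF M]] admissible_subgroup[OF N]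
    by (rule G.subgroups_Inter_pair[rotated])
  show "refinement N M k \<subseteq> N" by (simp add: refinement_def)
  show "M \<subseteq> refinement N M k" by (rule subset_refinement[OF M.subgroup_axioms \<open>M \<subseteq> N\<close>])
  show "h ` refinement N M k \<subseteq> refinement N M k"
    if h: "h \<in> hom G G" and "h ` M \<subseteq> M" "h ` N \<subseteq> N" for h
  proof safe
    fix x assume "x \<in> refinement N M k"
    then obtain m c where x: "x \<in> N" "m \<in> M" "c \<in> ?C" "x = m \<otimes>\<^bsub>G\<^esub> c"
      by (auto simp: refinement_def elim: set_multE)
    then have "h x = h m \<otimes>\<^bsub>G\<^esub> h c" using hom_mult[OF h] by simp
    moreover have "h c \<in> ?C" using G.lower_central_fully_invariant[OF h] x(3) by blast
    ultimately show "h x \<in> refinement N M k"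
      using x that unfolding refinement_def set_mult_def by blast
  qed
qed

lemma refinement_0: assumes "subgroup M G" "subgroup N G" shows "refinement N M 0 = N"
proof -
  interpret N: subgroup N G by fact
  have "x \<in> M <#>\<^bsub>G\<^esub> carrier G" if "x \<in> N" for x
    using set_multI[OF subgroup.one_closed[OF assms(1)], of x] N.mem_carrier[OF that] by simp
  then show ?thesis by (auto simp: refinement_def)
qed

lemma refinement_last:
  assumes "subgroup M G" "M \<subseteq> N" "lower_central G c = {\<one>\<^bsub>G\<^esub>}"
  shows "refinement N M c = M"
proof -
  interpret M: subgroup M G by fact
  have "M <#>\<^bsub>G\<^esub> {\<one>\<^bsub>G\<^esub>} = M" by (auto simp: set_mult_def)
  then show ?thesis using assms by (auto simp: refinement_def)
qed

lemma central_step_refinement: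
  assumes N: "admissible N" and M: "admissible M" and NM: "dot_closure N \<subseteq> M" "M \<subseteq> N"
  shows "central_step (refinement N M k) (refinement N M (Suc k))"
proof -
  let ?C = "lower_central G"
  interpret N: normal N G by (rule admissible_normal[OF N])
  interpret M: normal M G by (rule admissible_normal[OF M])
  interpret C: normal "?C k" G by (rule G.lower_central_normal)
  have M_sub: "M \<subseteq> refinement N M (Suc k)"
    by (rule subset_refinement[OF M.subgroup_axioms NM(2)])
  have dec: "refinement N M (Suc k) \<subseteq> refinement N M k"
    using G.lower_central_Suc_subset[of k] unfolding refinement_def set_mult_def by blast
  have "n \<otimes>\<^bsub>G\<^esub> g \<otimes>\<^bsub>G\<^esub> inv\<^bsub>G\<^esub> n \<otimes>\<^bsub>G\<^esub> inv\<^bsub>G\<^esub> g \<in> refinement N M (Suc k)"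
    if n: "n \<in> refinement N M k" and g: "g \<in> carrier G" for n g
  proof -
    obtain m c where mc: "n \<in> N" "m \<in> M" "c \<in> ?C k" "n = m \<otimes>\<^bsub>G\<^esub> c"
      using n by (auto simp: refinement_def elim: set_multE)
    have G: "n \<in> carrier G" "m \<in> carrier G" "c \<in> carrier G"
      using mc N.mem_carrier M.mem_carrier C.mem_carrier by blast+
    define d where "d = c \<otimes>\<^bsub>G\<^esub> g \<otimes>\<^bsub>G\<^esub> inv\<^bsub>G\<^esub> c \<otimes>\<^bsub>G\<^esub> inv\<^bsub>G\<^esub> g"
    have d: "d \<in> ?C (Suc k)" unfolding d_def by (rule G.commutator_in_lower_central[OF mc(3) g])
    have dG: "d \<in> carrier G" using G g by (simp add: d_def)
    have m': "m \<otimes>\<^bsub>G\<^esub> (d \<otimes>\<^bsub>G\<^esub> (g \<otimes>\<^bsub>G\<^esub> inv\<^bsub>G\<^esub> m \<otimes>\<^bsub>G\<^esub> inv\<^bsub>G\<^esub> g) \<otimes>\<^bsub>G\<^esub> inv\<^bsub>G\<^esub> d) \<in> M"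
      by (rule M.m_closed[OF mc(2) M.inv_op_closed2[OF dG M.inv_op_closed2[OF g M.m_inv_closed[OF mc(2)]]]])
    have "n \<otimes>\<^bsub>G\<^esub> (g \<otimes>\<^bsub>G\<^esub> inv\<^bsub>G\<^esub> n \<otimes>\<^bsub>G\<^esub> inv\<^bsub>G\<^esub> g) \<in> N"
      by (rule N.m_closed[OF mc(1) N.inv_op_closed2[OF g N.m_inv_closed[OF mc(1)]]])
    then have in_N: "n \<otimes>\<^bsub>G\<^esub> g \<otimes>\<^bsub>G\<^esub> inv\<^bsub>G\<^esub> n \<otimes>\<^bsub>G\<^esub> inv\<^bsub>G\<^esub> g \<in> N"
      using G(1) g by (simp only: G.m_assoc G.m_closed G.inv_closed)
    show ?thesis
      using set_multI[OF m' d] in_N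
      unfolding refinement_def G.commutator_mult_left[OF G(2,3) g d_def, symmetric] mc(4) by blast
  qed
  moreover have "dot_closure (refinement N M k) \<subseteq> refinement N M (Suc k)"
    using dot_closure_mono[of "refinement N M k" N] NM(1) M_sub unfolding refinement_def by blast
  ultimately show ?thesis
    unfolding central_step_def using admissible_refinement[OF assms] dec by blast
qed

lemma central_steps_if_right_nilpotent:
  assumes nil: "nilpotent_group G"
  shows "central_step\<^sup>*\<^sup>* (carrier G) ((dot_closure ^^ n) (carrier G))"
proof (induction n)
  case (Suc n)
  define N where "N = (dot_closure ^^ n) (carrier G)"
  define M where "M = dot_closure N"
  have N: "admissible N" unfolding N_def by (rule admissible_funpow_dot_closure)
  have M: "admissible M" unfolding M_def by (rule admissible_dot_closure[OF N])
  have NM: "dot_closure N \<subseteq> M" "M \<subseteq> N" using N by (auto simp: M_def admissible_iff)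
  obtain c where c: "lower_central G c = {\<one>\<^bsub>G\<^esub>}" using nil by (auto simp: nilpotent_group_def)
  have "central_step\<^sup>*\<^sup>* (refinement N M 0) (refinement N M k)" for k
    by (induction k) (auto intro: rtranclp.rtrancl_into_rtrancl central_step_refinement[OF N M NM])
  from this[of c] have "central_step\<^sup>*\<^sup>* N M"
    using refinement_0 refinement_last[OF _ NM(2) c] admissible_subgroup[OF N] admissible_subgroup[OF M]
    by simp
  then show ?case using Suc by (simp add: N_def M_def)
qed simp

section \<open>Right nilpotency and z-series\<close>

lemma quotient_carrier_eq:
  "carrier (B\<lparr>carrier := I\<rparr> Mod J) = {J #> x | x. x \<in> I}"
  by (auto simp: FactGroup_def RCOSETS_def r_coset_def)

lemma z_series_if_central_steps:
  assumes "central_step\<^sup>*\<^sup>* (carrier G) {\<one>}" shows "\<exists>I n. sb_z_series B I n"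
proof -
  obtain n f where f: "f 0 = carrier G" "f n = {\<one>}" "\<And>i. i < n \<Longrightarrow> central_step (f i) (f (Suc i))"
    using assms by (auto simp: rtranclp_power relpowp_fun_conv)
  have adm: "admissible (f i)" if "i \<le> n" for i
    using that f(1) f(3)[of "i - 1"] by (cases i) (auto simp: admissible_G central_step_def)
  have "lift (f (Suc i)) \<subseteq> lift (f i)" if "i < n" for i
    using f(3)[OF that] by (auto simp: central_step_def lift_def)
  moreover have "lift (f (Suc i)) #> a \<in> sb_socle (sb_quotient B (lift (f (Suc i))))"
    if "i < n" "a \<in> lift (f i)" for i a
  proof (rule coset_in_socleI)
    show "admissible (f (Suc i))" using adm[of "Suc i"] that by simp
    show "a \<in> carrier B" using that(2) by (rule lift_into_B)
    have "dot_closure (f i) \<subseteq> f (Suc i)" using f(3)[OF that(1)] by (simp add: central_step_def)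
    then show "act a g \<otimes>\<^bsub>G\<^esub> inv\<^bsub>G\<^esub> g \<in> f (Suc i)" if "g \<in> carrier G" for g
      using that \<open>a \<in> lift (f i)\<close> admissible_subgroup[OF \<open>admissible (f (Suc i))\<close>]
      by (simp add: dot_closure_subset_iff)
    show "proj a \<otimes>\<^bsub>G\<^esub> g \<otimes>\<^bsub>G\<^esub> inv\<^bsub>G\<^esub> (proj a) \<otimes>\<^bsub>G\<^esub> inv\<^bsub>G\<^esub> g \<in> f (Suc i)" if "g \<in> carrier G" for g
      using that \<open>a \<in> lift (f i)\<close> f(3)[OF \<open>i < n\<close>] by (simp add: central_step_def lift_def)
  qed
  ultimately have "lift (f j) \<subseteq> lift (f (j - 1)) \<and>
      carrier (B\<lparr>carrier := lift (f (j - 1))\<rparr> Mod lift (f j)) \<subseteq> sb_socle (sb_quotient B (lift (f j)))"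
    if "j \<in> {1..n}" for j
    using that by (cases j) (auto simp: quotient_carrier_eq)
  then have "sb_z_series B (\<lambda>i. lift (f i)) n"
    using f(1,2) lift_ideal adm by (simp add: sb_z_series_def lift_G idempotents_eq_lift)
  then show ?thesis by blast
qed

lemma right_nilpotent_if_z_series:
  assumes z: "sb_z_series B I n" shows "sb_right_nilpotent B"
proof -
  have E: "E \<subseteq> I j" if "j \<le> n" for j
    using that
  proof (induction rule: inc_induct)
    case (step j)
    then have "Suc j \<in> {1..n}" by simp
    with z have "I (Suc j) \<subseteq> I j" unfolding sb_z_series_def by (metis diff_Suc_1)
    with step show ?case by blast
  qed (use z in \<open>simp add: sb_z_series_def\<close>)
  define N where "N j = I j \<inter> carrier G" for j
  have adm: "admissible (N j)" and I_eq: "I j = lift (N j)" if "j \<le> n" for j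
    using z that ideal_admissible[of "I j"] ideal_eq_lift[of "I j"] E
    by (auto simp: sb_z_series_def N_def)
  have step: "dot_closure (N j) \<subseteq> N (Suc j)" if j: "j < n" for j
    unfolding dot_closure_subset_iff[OF admissible_subgroup[OF adm[OF Suc_leI[OF j]]]]
  proof (intro ballI)
    fix a g assume a: "a \<in> lift (N j)" and g: "g \<in> carrier G"
    have "Suc j \<in> {1..n}" using j by simp
    with z have "carrier (B\<lparr>carrier := I j\<rparr> Mod I (Suc j)) \<subseteq> sb_socle (sb_quotient B (I (Suc j)))"
      unfolding sb_z_series_def by (metis diff_Suc_1)
    then have "lift (N (Suc j)) #> a \<in> sb_socle (sb_quotient B (lift (N (Suc j))))"
      using a j by (auto simp: quotient_carrier_eq I_eq)
    then show "act a g \<otimes>\<^bsub>G\<^esub> inv\<^bsub>G\<^esub> g \<in> N (Suc j)"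
      using coset_in_socleD adm j a g lift_into_B by (meson Suc_leI)
  qed
  have "(dot_closure ^^ j) (carrier G) \<subseteq> N j" if "j \<le> n" for j
    using that
  proof (induction j)
    case 0
    then show ?case using z by (auto simp: N_def sb_z_series_def carrier_G)
  next
    case (Suc j)
    then have "dot_closure ((dot_closure ^^ j) (carrier G)) \<subseteq> dot_closure (N j)"
      by (intro dot_closure_mono) simp
    also have "\<dots> \<subseteq> N (Suc j)" using step[of j] Suc.prems by simp
    finally show ?case by simp
  qed
  moreover have "N n \<subseteq> {\<one>}"
    using z by (auto simp: N_def sb_z_series_def idempotents_eq carrier_G)
  ultimately have "(dot_closure ^^ n) (carrier G) \<subseteq> {\<one>}" by blast
  moreover have "\<one> \<in> (dot_closure ^^ n) (carrier G)"
    using subgroup.one_closed[OF admissible_subgroup[OF admissible_funpow_dot_closure]]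
    by (simp add: one_G)
  ultimately show ?thesis using right_nilpotent_iff by blast
qed

end

theorem proposition35:
  fixes B :: "('a, 'm) semibrace_scheme"
  assumes "left_semibrace B"
    and "nilpotent_group (sb_group B)"
  shows "sb_right_nilpotent B \<longleftrightarrow> (\<exists>I n. sb_z_series B I n)"
proof -
  interpret left_semibrace B by fact
  show ?thesis
    using right_nilpotent_iff central_steps_if_right_nilpotent[OF assms(2)]
      z_series_if_central_steps right_nilpotent_if_z_series by metis
qed

end
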